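(* Let $\mathcal F$ be a cost distribution with finite support $\mathcal C=\{c_1<\dots<c_{|\mathcal C|}\}$ and probabilities $\pi_t$, let $A$ be an allocation rule with $A_t=A(c_t)\in(0,1]$, and let $m:\mathcal Z\to[0,1]^d$ be a vector of moments attaining every extreme point of the hypercube $[0,1]^d$. The worst-case risk of the Horvitz-Thompson estimator $\hat\theta_S$ of $\mathbb E[m(z)]$ satisfies $$\frac nd\cdot\mathcal R^*(\hat\theta_S;\mathcal F,A)=\sup_{q\in[0,1]^{|\mathcal C|}}\ \sum_{t=1}^{|\mathcal C|}\pi_t\cdot\frac{q_t}{A_t}-\Big(\sum_{t=1}^{|\mathcal C|}\pi_tq_t\Big)^2 .$$
   Context: There are $n$ agents with pairs $(z_i,c_i)\in\mathcal Z\times\mathcal C$ drawn i.i.d. from a distribution $\mathcal D$; $\mathcal D$ is consistent with $\mathcal F$ if its cost marginal is $\mathcal F$. Given the costs, each agent $i$ is put in the sample $S$ with probability $A(c_i)$, independently of everything else. The parameter is $\theta=\mathbb E[m(z)]\in[0,1]^d$ and the Horvitz-Thompson estimator is $\hat\theta_S=\frac1n\sum_{i=1}^n\frac{1\{i\in S\}}{A(c_i)}\,m(z_i)$. The risk is $\mathcal R(\hat\theta_S;\mathcal D,A)=\mathbb E\big[\|\hat\theta_S-\theta\|_2^2\big]$ and the worst-case risk $\mathcal R^*(\hat\theta_S;\mathcal F,A)$ is its supremum over all $\mathcal D$ consistent with $\mathcal F$. *)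

theory Defs
  imports "HOL-Probability.Probability"
begin

text \<open>
  The types of agents form a measurable space \<open>MZ\<close>. Costs are reals, and the cost
  distribution is a pmf \<open>F\<close>, so that the set of costs is \<open>set_pmf F\<close>.
\<close>

definition consistent_laws :: "'z measure \<Rightarrow> real pmf \<Rightarrow> ('z \<times> real) measure set" where
  "consistent_laws MZ F =
    {D. prob_space D \<and> sets D = sets (MZ \<Otimes>\<^sub>M count_space (set_pmf F)) \<and>
        distr D (count_space UNIV) snd = measure_pmf F}"

definition profile_law :: "nat \<Rightarrow> ('z \<times> real) measure \<Rightarrow> (nat \<Rightarrow> 'z \<times> real) measure" where
  "profile_law n D = (\<Pi>\<^sub>M i\<in>{1..n}. D)"

definition sample_pmf :: "nat \<Rightarrow> (real \<Rightarrow> real) \<Rightarrow> (nat \<Rightarrow> real) \<Rightarrow> nat set pmf" where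
  "sample_pmf n A c =
    map_pmf (\<lambda>b. {i\<in>{1..n}. b i}) (Pi_pmf {1..n} False (\<lambda>i. bernoulli_pmf (A (c i))))"

text \<open>
  The joint law of the agents' profile and the sample: the conditional law of the sample
  given the profile depends on the costs only.
\<close>

definition experiment_law ::
    "nat \<Rightarrow> (real \<Rightarrow> real) \<Rightarrow> ('z \<times> real) measure \<Rightarrow> ((nat \<Rightarrow> 'z \<times> real) \<times> nat set) measure" where
  "experiment_law n A D =
    profile_law n D \<bind>
      (\<lambda>w. distr (measure_pmf (sample_pmf n A (\<lambda>i. snd (w i))))
             (profile_law n D \<Otimes>\<^sub>M count_space UNIV) (\<lambda>S. (w, S)))"

definition moment :: "('z \<Rightarrow> real ^ 'd) \<Rightarrow> ('z \<times> real) measure \<Rightarrow> real ^ 'd" where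
  "moment m D = (LINT x|D. m (fst x))"

definition horvitz_thompson ::
    "nat \<Rightarrow> (real \<Rightarrow> real) \<Rightarrow> ('z \<Rightarrow> real ^ 'd) \<Rightarrow> (nat \<Rightarrow> 'z \<times> real) \<Rightarrow> nat set \<Rightarrow> real ^ 'd" where
  "horvitz_thompson n A m w S =
    (1 / real n) *\<^sub>R (\<Sum>i\<in>{1..n}. (of_bool (i \<in> S) / A (snd (w i))) *\<^sub>R m (fst (w i)))"

definition risk ::
    "nat \<Rightarrow> (real \<Rightarrow> real) \<Rightarrow> ('z \<Rightarrow> real ^ 'd) \<Rightarrow> ('z \<times> real) measure \<Rightarrow> real" where
  "risk n A m D =
    (LINT x|experiment_law n A D. (norm (horvitz_thompson n A m (fst x) (snd x) - moment m D))\<^sup>2)"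

text \<open>
  The supremum is taken in the extended reals, where it is meaningful without a boundedness side condition.
\<close>

definition worst_case_risk ::
    "nat \<Rightarrow> 'z measure \<Rightarrow> (real \<Rightarrow> real) \<Rightarrow> ('z \<Rightarrow> real ^ 'd) \<Rightarrow> real pmf \<Rightarrow> ereal" where
  "worst_case_risk n MZ A m F = (SUP D\<in>consistent_laws MZ F. ereal (risk n A m D))"

end

theory Submission
  imports Defs
begin

text \<open>
  The centred summands of the estimator are independent, first over the sample given the profile
  and then over the agents, so that \<open>n\<close> times the risk is the sum over the coordinates \<open>j\<close> of
  \<open>E[m\<^sub>j(z)\<^sup>2 / A(c)] - \<theta>\<^sub>j\<^sup>2\<close>. Since \<open>m\<^sub>j\<^sup>2 \<le> m\<^sub>j\<close>, the \<open>j\<close>-th term is at most the objective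
  at \<open>q\<^sub>t = E[m\<^sub>j(z) | c = c\<^sub>t]\<close>, hence the largest of them dominates the average. Conversely, the
  objective at \<open>q\<close> is attained by letting \<open>m(z)\<close> be the all-ones vector with probability \<open>q\<^sub>t\<close>
  given the cost \<open>c\<^sub>t\<close> and the zero vector otherwise: all coordinates then contribute
  equally, and \<open>m\<^sub>j\<^sup>2 = m\<^sub>j\<close>.
\<close>

section \<open>Second moments of sums of independent variables\<close>

text \<open>Expanding the square gives products over pairs: independence factorises those off the
  diagonal, and each diagonal product exceeds the product of means by the variance
  \<open>d i\<close>. The means are kept because, given the profile, the summands of the estimation
  error are not centred.\<close>

lemma (in prob_space) expectation_square_sum_indep:
  fixes X :: "'i \<Rightarrow> 'a \<Rightarrow> real"
  assumes I: "finite I" "indep_vars (\<lambda>_. borel) X I"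
    and X: "\<And>i. i \<in> I \<Longrightarrow> integrable M (X i)"
    and X2: "\<And>i. i \<in> I \<Longrightarrow> integrable M (\<lambda>\<omega>. (X i \<omega>)\<^sup>2)"
  shows "expectation (\<lambda>\<omega>. (\<Sum>i\<in>I. X i \<omega>)\<^sup>2) =
    (\<Sum>i\<in>I. expectation (\<lambda>\<omega>. (X i \<omega>)\<^sup>2) - (expectation (X i))\<^sup>2) + (\<Sum>i\<in>I. expectation (X i))\<^sup>2"
    and "integrable M (\<lambda>\<omega>. (\<Sum>i\<in>I. X i \<omega>)\<^sup>2)"
proof -
  define d where "d i = expectation (\<lambda>\<omega>. (X i \<omega>)\<^sup>2) - (expectation (X i))\<^sup>2" for i
  have pair: "integrable M (\<lambda>\<omega>. X i \<omega> * X j \<omega>) \<and>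
    expectation (\<lambda>\<omega>. X i \<omega> * X j \<omega>) =
      expectation (X i) * expectation (X j) + (if i = j then d i else 0)"
    if ij: "i \<in> I" "j \<in> I" for i j
  proof (cases "i = j")
    case True
    then show ?thesis
      using X2[of i] ij by (simp add: power2_eq_square d_def)
  next
    case False
    have "indep_vars (\<lambda>_. borel) X {i, j}"
      using indep_vars_subset[OF I(2)] ij by auto
    then show ?thesis
      using indep_vars_lebesgue_integral[of "{i, j}" X] indep_vars_integrable[of "{i, j}" X]
        X ij False by auto
  qed
  have "expectation (\<lambda>\<omega>. (\<Sum>i\<in>I. X i \<omega>)\<^sup>2) =
      expectation (\<lambda>\<omega>. \<Sum>i\<in>I. \<Sum>j\<in>I. X i \<omega> * X j \<omega>)"
    by (simp add: power2_eq_square sum_product)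
  also have "\<dots> = (\<Sum>i\<in>I. \<Sum>j\<in>I. expectation (\<lambda>\<omega>. X i \<omega> * X j \<omega>))"
    using pair by (simp add: Bochner_Integration.integral_sum)
  also have "\<dots> = (\<Sum>i\<in>I. \<Sum>j\<in>I. expectation (X i) * expectation (X j) + (if i = j then d i else 0))"
    using pair by simp
  also have "\<dots> = (\<Sum>i\<in>I. expectation (X i))\<^sup>2 + (\<Sum>i\<in>I. d i)"
    using I(1) by (simp add: sum.distrib power2_eq_square sum_product)
  finally show "expectation (\<lambda>\<omega>. (\<Sum>i\<in>I. X i \<omega>)\<^sup>2) =
    (\<Sum>i\<in>I. expectation (\<lambda>\<omega>. (X i \<omega>)\<^sup>2) - (expectation (X i))\<^sup>2) + (\<Sum>i\<in>I. expectation (X i))\<^sup>2"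
    by (simp add: d_def)
  show "integrable M (\<lambda>\<omega>. (\<Sum>i\<in>I. X i \<omega>)\<^sup>2)"
    using pair by (simp add: power2_eq_square sum_product)
qed

text \<open>This is the form for the coin flips that decide the sample once the profile is fixed.
  Finiteness of the type \<open>'b\<close> makes every function of a single coordinate
  integrable.\<close>

lemma expectation_square_sum_Pi_pmf:
  fixes f :: "'i \<Rightarrow> 'b::finite \<Rightarrow> real"
  assumes I: "finite I"
  shows "measure_pmf.expectation (Pi_pmf I d p) (\<lambda>b. (\<Sum>i\<in>I. f i (b i))\<^sup>2) =
    (\<Sum>i\<in>I. measure_pmf.expectation (p i) (\<lambda>b. (f i b)\<^sup>2) - (measure_pmf.expectation (p i) (f i))\<^sup>2) +
    (\<Sum>i\<in>I. measure_pmf.expectation (p i) (f i))\<^sup>2"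
proof -
  have comp: "p i = map_pmf (\<lambda>b. b i) (Pi_pmf I d p)" if "i \<in> I" for i
    using Pi_pmf_component[OF I, of i d p] that by simp
  have E: "measure_pmf.expectation (Pi_pmf I d p) (\<lambda>b. g (b i)) = measure_pmf.expectation (p i) g"
    if "i \<in> I" for i and g :: "'b \<Rightarrow> real"
    by (subst comp[OF that]) simp
  have int: "integrable (Pi_pmf I d p) (\<lambda>b. g (b i))" if "i \<in> I" for i and g :: "'b \<Rightarrow> real"
  proof -
    have "integrable (p i) g"
      by (rule integrable_measure_pmf_finite) simp
    then show ?thesis
      by (subst (asm) comp[OF that]) simp
  qed
  have "prob_space.indep_vars (Pi_pmf I d p) (\<lambda>_. borel) (\<lambda>i b. f i (b i)) I"
    by (rule prob_space.indep_vars_compose2[OF measure_pmf.prob_space_axioms indep_vars_Pi_pmf[OF I]])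
      simp
  from prob_space.expectation_square_sum_indep(1)[OF measure_pmf.prob_space_axioms I this]
  show ?thesis
    using E[of _ "\<lambda>x. (f _ x)\<^sup>2"] int[of _ "\<lambda>x. (f _ x)\<^sup>2"] by (simp add: E int)
qed

lemma integral_PiM_component:
  fixes h :: "'a \<Rightarrow> real"
  assumes "prob_space D" "i \<in> I" "integrable D h"
  shows "(LINT w|(\<Pi>\<^sub>M i\<in>I. D). h (w i)) = (LINT x|D. h x)"
    and "integrable (\<Pi>\<^sub>M i\<in>I. D) (\<lambda>w. h (w i))"
proof -
  have comp: "distr (\<Pi>\<^sub>M i\<in>I. D) D (\<lambda>w. w i) = D"
    using distr_PiM_component[of I "\<lambda>_. D" i] assms by simp
  show "(LINT w|(\<Pi>\<^sub>M i\<in>I. D). h (w i)) = (LINT x|D. h x)"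
    and "integrable (\<Pi>\<^sub>M i\<in>I. D) (\<lambda>w. h (w i))"
    using assms integral_distr[of "\<lambda>w. w i" "\<Pi>\<^sub>M i\<in>I. D" D h]
      integrable_distr_eq[of "\<lambda>w. w i" "\<Pi>\<^sub>M i\<in>I. D" D h]
    by (simp_all add: comp)
qed

text \<open>This is the form for the i.i.d. agents, where the same function \<open>g\<close> is
  applied to each coordinate.\<close>

lemma expectation_square_sum_PiM:
  fixes g :: "'a \<Rightarrow> real"
  assumes D: "prob_space D" and I: "finite I" "I \<noteq> {}"
    and g: "integrable D g" "integrable D (\<lambda>x. (g x)\<^sup>2)"
  shows "(LINT w|(\<Pi>\<^sub>M i\<in>I. D). (\<Sum>i\<in>I. g (w i))\<^sup>2) =
    real (card I) * (LINT x|D. (g x)\<^sup>2) - real (card I) * (LINT x|D. g x)\<^sup>2 +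
    (real (card I) * (LINT x|D. g x))\<^sup>2"
    and "integrable (\<Pi>\<^sub>M i\<in>I. D) (\<lambda>w. (\<Sum>i\<in>I. g (w i))\<^sup>2)"
proof -
  interpret P: prob_space "\<Pi>\<^sub>M i\<in>I. D"
    by (intro prob_space_PiM D)
  have comp: "distr (\<Pi>\<^sub>M i\<in>I. D) D (\<lambda>w. w i) = D" if "i \<in> I" for i
    using distr_PiM_component[of I "\<lambda>_. D" i] D that by simp
  have "P.indep_vars (\<lambda>_. D) (\<lambda>i w. w i) I"
  \<comment> \<open>The joint map of the projections is the identity on the product space, so its
    law is already the product of the marginals.\<close>
  proof (subst P.indep_vars_iff_distr_eq_PiM'[OF I(2)])
    have "distr (\<Pi>\<^sub>M i\<in>I. D) (\<Pi>\<^sub>M i\<in>I. D) (\<lambda>w. \<lambda>i\<in>I. w i) =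
        distr (\<Pi>\<^sub>M i\<in>I. D) (\<Pi>\<^sub>M i\<in>I. D) (\<lambda>w. w)"
      by (intro distr_cong) (auto simp: space_PiM PiE_iff extensional_restrict)
    then show "distr (\<Pi>\<^sub>M i\<in>I. D) (\<Pi>\<^sub>M i\<in>I. D) (\<lambda>w. \<lambda>i\<in>I. w i) =
        (\<Pi>\<^sub>M i\<in>I. distr (\<Pi>\<^sub>M i\<in>I. D) D (\<lambda>w. w i))"
      by (simp add: comp cong: PiM_cong)
  qed simp
  then have indep: "P.indep_vars (\<lambda>_. borel) (\<lambda>i w. g (w i)) I"
    by (rule P.indep_vars_compose2) (use g in simp)
  show "(LINT w|(\<Pi>\<^sub>M i\<in>I. D). (\<Sum>i\<in>I. g (w i))\<^sup>2) =
    real (card I) * (LINT x|D. (g x)\<^sup>2) - real (card I) * (LINT x|D. g x)\<^sup>2 +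
    (real (card I) * (LINT x|D. g x))\<^sup>2"
    and "integrable (\<Pi>\<^sub>M i\<in>I. D) (\<lambda>w. (\<Sum>i\<in>I. g (w i))\<^sup>2)"
    using P.expectation_square_sum_indep[OF I(1) indep]
      integral_PiM_component[OF D _ g(1), of _ I] integral_PiM_component[OF D _ g(2), of _ I]
    by (simp_all add: algebra_simps)
qed

section \<open>Measurability of the sampling kernel\<close>

text \<open>The law of the sample factors through the vector of costs. That vector takes finitely
  many values and is measurable into a discrete space, from which every map into the space of
  subprobabilities is measurable.\<close>

lemma measurable_sample_pmf:
  assumes sets_D: "sets D = sets (MZ \<Otimes>\<^sub>M count_space C)" and C: "finite C"
  shows "(\<lambda>w. measure_pmf (sample_pmf n A (\<lambda>i. snd (w i)))) \<in>
    measurable (profile_law n D) (subprob_algebra (count_space UNIV))"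
proof -
  \<comment> \<open>Restricting to \<open>{1..n}\<close> puts the cost vector in the finite set of
    extensional functions.\<close>
  define costs :: "(nat \<Rightarrow> 'a \<times> real) \<Rightarrow> nat \<Rightarrow> real" where "costs w = (\<lambda>i\<in>{1..n}. snd (w i))" for w
  have [measurable_cong]: "sets D = sets (MZ \<Otimes>\<^sub>M count_space C)"
    by fact
  have fin: "finite ({1..n} \<rightarrow>\<^sub>E C)"
    using C by (intro finite_PiE) auto
  have cost_i: "(\<lambda>w. snd (w i)) \<in> measurable (profile_law n D) (count_space C)"
    if "i \<in> {1..n}" for i
    using that unfolding profile_law_def by measurable
  have costs: "costs \<in> measurable (profile_law n D) (count_space ({1..n} \<rightarrow>\<^sub>E C))"
  proof (subst measurable_count_space_eq_countable[OF countable_finite[OF fin]], intro conjI ballI Pi_I)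
    fix w assume "w \<in> space (profile_law n D)"
    then show "costs w \<in> {1..n} \<rightarrow>\<^sub>E C"
      using sets_eq_imp_space_eq[OF sets_D]
      by (auto simp: costs_def profile_law_def space_PiM PiE_iff space_pair_measure)
  next
    fix a assume a: "a \<in> {1..n} \<rightarrow>\<^sub>E C"
    have "costs -` {a} \<inter> space (profile_law n D) =
        {w \<in> space (profile_law n D). \<forall>i\<in>{1..n}. snd (w i) = a i}"
      using a by (auto simp: costs_def fun_eq_iff PiE_iff extensional_def)
    also have "\<dots> \<in> sets (profile_law n D)"
    proof (rule sets.sets_Collect_finite_All)
      show "{w \<in> space (profile_law n D). snd (w i) = a i} \<in> sets (profile_law n D)"
        if i: "i \<in> {1..n}" for i
        using measurable_sets[OF cost_i[OF i], of "{a i}"] a i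
        by (auto simp: vimage_def Int_def conj_commute PiE_iff)
    qed simp
    finally show "costs -` {a} \<inter> space (profile_law n D) \<in> sets (profile_law n D)" .
  qed
  have "sample_pmf n A (\<lambda>i. snd (w i)) = sample_pmf n A (costs w)" for w
    unfolding sample_pmf_def by (intro arg_cong[where f = "map_pmf _"] Pi_pmf_cong) (auto simp: costs_def)
  moreover have "(\<lambda>w. measure_pmf (sample_pmf n A (costs w))) \<in>
      measurable (profile_law n D) (subprob_algebra (count_space UNIV))"
    by (rule measurable_compose[OF costs])
      (auto simp: space_subprob_algebra intro!: measure_pmf.subprob_space_axioms)
  ultimately show ?thesis
    by simp
qed


section \<open>Risk of the estimator under a fixed law\<close>

text \<open>One law of type and cost is fixed. Finitely many costs with positive \<open>A\<close>,
  together with bounded moments, keep all the integrands below bounded.\<close>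

locale survey = prob_space D for D :: "('z \<times> real) measure" +
  fixes MZ :: "'z measure" and C :: "real set" and A :: "real \<Rightarrow> real"
    and m :: "'z \<Rightarrow> real ^ 'd"
  assumes sets_D: "sets D = sets (MZ \<Otimes>\<^sub>M count_space C)"
    and finite_C: "finite C"
    and A: "\<And>x. x \<in> C \<Longrightarrow> 0 < A x \<and> A x \<le> 1"
    and m_measurable: "m \<in> borel_measurable MZ"
    and m_bounded: "bounded (m ` space MZ)"
begin

declare sets_D [measurable_cong] m_measurable [measurable]

lemma space_D: "space D = space MZ \<times> C"
  using sets_eq_imp_space_eq[OF sets_D] by (simp add: space_pair_measure)

lemma measurable_snd_D [measurable]: "snd \<in> measurable D (count_space C)"
  by measurable

lemma measurable_cost [measurable]: "(\<lambda>x. f (snd x)) \<in> borel_measurable D" for f :: "real \<Rightarrow> real"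
  by (rule measurable_compose[OF measurable_snd_D]) simp

lemma measurable_m [measurable]: "(\<lambda>x. m (fst x)) \<in> borel_measurable D"
  by measurable

lemma measurable_m_component [measurable]: "(\<lambda>x. m (fst x) $ j) \<in> borel_measurable D"
  by (rule measurable_compose[OF measurable_m]) (intro borel_measurable_continuous_onI continuous_intros)

lemma bounds:
  obtains B where "0 \<le> B" "\<And>z. z \<in> space MZ \<Longrightarrow> norm (m z) \<le> B" "\<And>x. x \<in> C \<Longrightarrow> 1 / A x \<le> B"
proof -
  obtain B where B: "\<And>z. z \<in> space MZ \<Longrightarrow> norm (m z) \<le> B"
    using m_bounded by (auto simp: bounded_iff)
  have "bounded ((\<lambda>x. 1 / A x) ` C)"
    using finite_C by (intro finite_imp_bounded) simp
  then obtain B' where B': "\<And>x. x \<in> C \<Longrightarrow> \<bar>1 / A x\<bar> \<le> B'"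
    by (auto simp: bounded_iff)
  show ?thesis
  proof (rule that[of "max 0 (max B B')"])
    show "norm (m z) \<le> max 0 (max B B')" if "z \<in> space MZ" for z
      using B[OF that] by simp
    show "1 / A x \<le> max 0 (max B B')" if "x \<in> C" for x
      using B'[OF that] by linarith
  qed simp
qed

text \<open>The weight \<open>f\<close> is arbitrary because any function is bounded on the finite
  set \<open>C\<close>; it is later taken to be \<open>1 / A\<close>, the indicator of a cost, or
  the constant 1.\<close>

lemma integrable_moments:
  shows "integrable D (\<lambda>x. m (fst x))"
    and "integrable D (\<lambda>x. m (fst x) $ j * f (snd x))"
    and "integrable D (\<lambda>x. (m (fst x) $ j)\<^sup>2 * f (snd x))"
proof -
  obtain B where B: "0 \<le> B" "\<And>z. z \<in> space MZ \<Longrightarrow> norm (m z) \<le> B"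
    using bounds by metis
  have "bounded (f ` C)"
    using finite_C by (intro finite_imp_bounded) simp
  then obtain B' where B': "\<And>x. x \<in> C \<Longrightarrow> \<bar>f x\<bar> \<le> B'"
    by (auto simp: bounded_iff)
  have mj: "\<bar>m z $ j\<bar> \<le> B" if "z \<in> space MZ" for z
    using component_le_norm_cart[of "m z" j] B(2)[OF that] by linarith
  have mj2: "(m z $ j)\<^sup>2 \<le> B\<^sup>2" if "z \<in> space MZ" for z
    using power_mono[OF mj[OF that], of 2] by simp
  show "integrable D (\<lambda>x. m (fst x))"
    by (rule integrable_const_bound[where B = B]) (auto intro!: AE_I2 B simp: space_D)
  show "integrable D (\<lambda>x. m (fst x) $ j * f (snd x))"
    by (rule integrable_const_bound[where B = "B * B'"])
      (auto intro!: AE_I2 mult_mono mj B' B simp: space_D abs_mult)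
  show "integrable D (\<lambda>x. (m (fst x) $ j)\<^sup>2 * f (snd x))"
    by (rule integrable_const_bound[where B = "B\<^sup>2 * B'"])
      (auto intro!: AE_I2 mult_mono mj2 B' B simp: space_D abs_mult)
qed

lemma moment_component: "moment m D $ j = (LINT x|D. m (fst x) $ j)"
proof -
  have "(LINT x|D. m (fst x)) \<bullet> axis j 1 = (LINT x|D. m (fst x) \<bullet> axis j 1)"
    by (rule integral_inner_left [symmetric]) (rule integrable_moments)
  then show ?thesis
    by (simp add: moment_def cart_eq_inner_axis)
qed

text \<open>The experiment law is a \<open>bind\<close>, so its integral splits into an outer one
  over profiles and an inner one over samples, provided that the integrand is bounded and the kernel
  is measurable.\<close>

lemma risk_eq_iterated:
  "risk n A m D =
    (LINT w|profile_law n D. LINT S|sample_pmf n A (\<lambda>i. snd (w i)).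
      (norm (horvitz_thompson n A m w S - moment m D))\<^sup>2)"
proof -
  let ?P = "profile_law n D"
  let ?K = "?P \<Otimes>\<^sub>M count_space (UNIV :: nat set set)"
  let ?f = "\<lambda>x. (norm (horvitz_thompson n A m (fst x) (snd x) - moment m D))\<^sup>2"
  obtain B where B: "0 \<le> B" "\<And>z. z \<in> space MZ \<Longrightarrow> norm (m z) \<le> B" "\<And>x. x \<in> C \<Longrightarrow> 1 / A x \<le> B"
    using bounds by metis
  interpret P: prob_space ?P
    unfolding profile_law_def by (intro prob_space_PiM prob_space_axioms)
  have [measurable]: "(\<lambda>w. w i) \<in> measurable ?P D" if "i \<in> {1..n}" for i
    using that unfolding profile_law_def by measurable
  have [measurable]: "(\<lambda>x. of_bool (i \<in> snd x) :: real) \<in> borel_measurable ?K" for i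
    by (rule measurable_compose[OF measurable_snd]) simp
  have f: "?f \<in> borel_measurable ?K"
    unfolding horvitz_thompson_def by measurable
  \<comment> \<open>The constant \<open>B\<close> bounds both the inverse weights and the moments,
    so each summand of the estimator has norm at most \<open>B * B\<close>.\<close>
  have f_bound: "\<bar>?f x\<bar> \<le> ((1 / real n) * (\<Sum>i\<in>{1..n}. B * B) + norm (moment m D))\<^sup>2"
    if x: "x \<in> space ?K" for x
  proof -
    obtain w S where x_eq: "x = (w, S)" and w: "w \<in> space ?P"
      using x by (cases x) (auto simp: space_pair_measure)
    have wi: "w i \<in> space MZ \<times> C" if "i \<in> {1..n}" for i
      using w that by (auto simp: profile_law_def space_PiM PiE_iff space_D)
    have "norm ((of_bool (i \<in> S) / A (snd (w i))) *\<^sub>R m (fst (w i))) \<le> B * B" if "i \<in> {1..n}" for i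
    proof -
      have "\<bar>of_bool (i \<in> S) / A (snd (w i))\<bar> \<le> B"
        using wi[OF that] A[of "snd (w i)"] B(1) B(3)[of "snd (w i)"] by (auto simp: of_bool_def)
      then show ?thesis
        unfolding norm_scaleR using wi[OF that] B by (intro mult_mono) auto
    qed
    then have "norm (horvitz_thompson n A m w S) \<le> (1 / real n) * (\<Sum>i\<in>{1..n}. B * B)"
      unfolding horvitz_thompson_def norm_scaleR
      by (auto intro!: mult_mono divide_right_mono sum_norm_le simp del: sum_constant)
    then have "norm (horvitz_thompson n A m w S - moment m D) \<le>
        (1 / real n) * (\<Sum>i\<in>{1..n}. B * B) + norm (moment m D)"
      using norm_triangle_ineq4[of "horvitz_thompson n A m w S" "moment m D"] by linarith
    then show ?thesis
      by (simp add: x_eq power_mono del: sum_constant)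
  qed
  have kernel: "(\<lambda>w. distr (measure_pmf (sample_pmf n A (\<lambda>i. snd (w i)))) ?K (\<lambda>S. (w, S))) \<in>
      measurable ?P (subprob_algebra ?K)"
    by (rule measurable_distr2[OF _ measurable_sample_pmf[OF sets_D finite_C]]) simp
  have "risk n A m D =
      (LINT w|?P. LINT x|distr (measure_pmf (sample_pmf n A (\<lambda>i. snd (w i)))) ?K (\<lambda>S. (w, S)). ?f x)"
    unfolding risk_def experiment_law_def
    \<comment> \<open>The value \<open>B' = 1\<close> bounds the total mass of the kernel.\<close>
    by (rule integral_bind[OF f f_bound kernel P.finite_measure_axioms, where B' = 1])
      (use measurable_space[OF kernel] in \<open>auto intro!: AE_I2 subprob_space.subprob_emeasure_le_1
        simp: space_subprob_algebra\<close>)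
  also have "\<dots> = (LINT w|?P. LINT S|sample_pmf n A (\<lambda>i. snd (w i)). ?f (w, S))"
    by (intro Bochner_Integration.integral_cong refl integral_distr[OF _ f]) (auto simp: space_pair_measure)
  finally show ?thesis
    by simp
qed


text \<open>Given the profile, inverse weighting makes each summand unbiased for
  \<open>m (fst (w i))\<close>, and the coins are independent across agents. The factor
  \<open>* 1\<close> gives both terms the shape of the third part of
  \<open>integrable_moments\<close>.\<close>

lemma expectation_sample:
  assumes n: "n \<ge> 1" and w: "w \<in> space (profile_law n D)"
  shows "(LINT S|sample_pmf n A (\<lambda>i. snd (w i)).
      (norm (horvitz_thompson n A m w S - \<theta>))\<^sup>2) =
    (1 / real n)\<^sup>2 * (\<Sum>j\<in>UNIV.
      (\<Sum>i\<in>{1..n}. (m (fst (w i)) $ j)\<^sup>2 * (1 / A (snd (w i))) - (m (fst (w i)) $ j)\<^sup>2 * 1) +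
      (\<Sum>i\<in>{1..n}. m (fst (w i)) $ j - \<theta> $ j)\<^sup>2)"
proof -
  define p where "p i = bernoulli_pmf (A (snd (w i)))" for i
  define f where "f j i b = of_bool b / A (snd (w i)) * m (fst (w i)) $ j - \<theta> $ j" for j i b
  have Ai: "0 < A (snd (w i))" "A (snd (w i)) \<le> 1" if "i \<in> {1..n}" for i
  proof -
    have "snd (w i) \<in> C"
      using w that by (auto simp: profile_law_def space_PiM PiE_iff space_D mem_Times_iff)
    then show "0 < A (snd (w i))" "A (snd (w i)) \<le> 1"
      using A by auto
  qed
  have E1: "measure_pmf.expectation (p i) (f j i) = m (fst (w i)) $ j - \<theta> $ j"
    if "i \<in> {1..n}" for i j
    using Ai[OF that] by (simp add: p_def f_def field_simps)
  \<comment> \<open>The variance of a Bernoulli variable with parameter \<open>a\<close>, scaled by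
    \<open>m / a\<close>, is m^2 / a^2 * a * (1 - a) = m^2 / a - m^2.\<close>
  have E2: "measure_pmf.expectation (p i) (\<lambda>b. (f j i b)\<^sup>2) - (m (fst (w i)) $ j - \<theta> $ j)\<^sup>2 =
      (m (fst (w i)) $ j)\<^sup>2 * (1 / A (snd (w i))) - (m (fst (w i)) $ j)\<^sup>2 * 1"
    if "i \<in> {1..n}" for i j
    using Ai[OF that] by (simp add: p_def f_def field_simps power2_eq_square)
  have norm_eq: "(norm (horvitz_thompson n A m w {i\<in>{1..n}. b i} - \<theta>))\<^sup>2 =
      (1 / real n)\<^sup>2 * (\<Sum>j\<in>UNIV. (\<Sum>i\<in>{1..n}. f j i (b i))\<^sup>2)" for b
  proof -
    have "(horvitz_thompson n A m w {i\<in>{1..n}. b i} - \<theta>) $ j =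
        (1 / real n) * (\<Sum>i\<in>{1..n}. f j i (b i))" for j
      using n by (simp add: horvitz_thompson_def f_def sum_subtractf right_diff_distrib)
    then show ?thesis
      by (simp add: norm_vec_def L2_set_def sum_nonneg power_divide sum_distrib_left
        sum_divide_distrib [symmetric])
  qed
  have int: "integrable (Pi_pmf {1..n} False p) (g :: _ \<Rightarrow> real)" for g
    by (intro integrable_measure_pmf_finite finite_subset[OF set_Pi_pmf_subset'] finite_PiE_dflt) auto
  have "(LINT S|sample_pmf n A (\<lambda>i. snd (w i)). (norm (horvitz_thompson n A m w S - \<theta>))\<^sup>2) =
      (LINT b|Pi_pmf {1..n} False p. (norm (horvitz_thompson n A m w {i\<in>{1..n}. b i} - \<theta>))\<^sup>2)"
    unfolding sample_pmf_def p_def by (rule integral_map_pmf)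
  also have "\<dots> = (1 / real n)\<^sup>2 * (\<Sum>j\<in>UNIV.
        measure_pmf.expectation (Pi_pmf {1..n} False p) (\<lambda>b. (\<Sum>i\<in>{1..n}. f j i (b i))\<^sup>2))"
    unfolding norm_eq integral_mult_right_zero
    by (subst Bochner_Integration.integral_sum) (simp_all only: int)
  also have "\<dots> = (1 / real n)\<^sup>2 * (\<Sum>j\<in>UNIV.
      (\<Sum>i\<in>{1..n}. (m (fst (w i)) $ j)\<^sup>2 * (1 / A (snd (w i))) - (m (fst (w i)) $ j)\<^sup>2 * 1) +
      (\<Sum>i\<in>{1..n}. m (fst (w i)) $ j - \<theta> $ j)\<^sup>2)"
    by (simp only: expectation_square_sum_Pi_pmf[OF finite_atLeastAtMost] E1 E2 cong: sum.cong)
  finally show ?thesis .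
qed

text \<open>This is the law of total variance. In coordinate \<open>j\<close> an agent contributes
  E[m_j^2 / A] - E[m_j^2] from the sampling and E[m_j^2] - \<theta>_j^2 from the draw of the
  profile; the term E[m_j^2] cancels.\<close>

lemma risk_eq:
  assumes n: "n \<ge> 1"
  shows "real n * risk n A m D =
    (\<Sum>j\<in>UNIV. (LINT x|D. (m (fst x) $ j)\<^sup>2 * (1 / A (snd x))) - (moment m D $ j)\<^sup>2)"
proof -
  let ?P = "\<Pi>\<^sub>M i\<in>{1..n}. D"
  let ?\<theta> = "moment m D"
  let ?v = "\<lambda>j x. (m (fst x) $ j)\<^sup>2 * (1 / A (snd x)) - (m (fst x) $ j)\<^sup>2 * 1"
  have v: "integrable D (?v j)" for j
    by (intro Bochner_Integration.integrable_diff integrable_moments)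
  have m1: "integrable D (\<lambda>x. m (fst x) $ j)" and m2: "integrable D (\<lambda>x. (m (fst x) $ j)\<^sup>2)" for j
    using integrable_moments(2,3)[of j "\<lambda>_. 1"] by simp_all
  \<comment> \<open>Centring at the moment annihilates the mean, so that only \<open>n\<close> times
    the variance survives in the sum over agents.\<close>
  have g: "integrable D (\<lambda>x. m (fst x) $ j - ?\<theta> $ j)"
      "integrable D (\<lambda>x. (m (fst x) $ j - ?\<theta> $ j)\<^sup>2)"
      "(LINT x|D. m (fst x) $ j - ?\<theta> $ j) = 0"
      "(LINT x|D. (m (fst x) $ j - ?\<theta> $ j)\<^sup>2) = (LINT x|D. (m (fst x) $ j)\<^sup>2) - (?\<theta> $ j)\<^sup>2" for j
    using m1[of j] m2[of j] moment_component[of j] variance_eq[OF m1 m2, of j]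
    by (simp_all add: power2_diff prob_space)
  have sq_int: "integrable ?P (\<lambda>w. (\<Sum>i\<in>{1..n}. m (fst (w i)) $ j - ?\<theta> $ j)\<^sup>2)" for j
    using expectation_square_sum_PiM(2)[OF prob_space_axioms finite_atLeastAtMost _ g(1,2)] n by simp
  have v_int: "integrable ?P (\<lambda>w. \<Sum>i\<in>{1..n}. ?v j (w i))" for j
    by (intro Bochner_Integration.integrable_sum integral_PiM_component prob_space_axioms v)
  have sum_v: "(LINT w|?P. (\<Sum>i\<in>{1..n}. ?v j (w i))) = real n * (LINT x|D. ?v j x)" for j
  proof -
    have "(LINT w|?P. (\<Sum>i\<in>{1..n}. ?v j (w i))) = (\<Sum>i\<in>{1..n}. LINT w|?P. ?v j (w i))"
      by (intro Bochner_Integration.integral_sum integral_PiM_component prob_space_axioms v)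
    also have "\<dots> = (\<Sum>i\<in>{1..n}. LINT x|D. ?v j x)"
      by (intro sum.cong refl integral_PiM_component prob_space_axioms v)
    finally show ?thesis
      by simp
  qed
  have sum_sq: "(LINT w|?P. (\<Sum>i\<in>{1..n}. m (fst (w i)) $ j - ?\<theta> $ j)\<^sup>2) =
      real n * ((LINT x|D. (m (fst x) $ j)\<^sup>2) - (?\<theta> $ j)\<^sup>2)" for j
  proof -
    have "{1..n} \<noteq> {}"
      using n by simp
    from expectation_square_sum_PiM(1)[OF prob_space_axioms finite_atLeastAtMost this g(1,2)[of j]]
    show ?thesis
      by (simp only: g) simp
  qed
  have v_diff: "(LINT x|D. ?v j x) =
      (LINT x|D. (m (fst x) $ j)\<^sup>2 * (1 / A (snd x))) - (LINT x|D. (m (fst x) $ j)\<^sup>2)" for j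
    using integrable_moments(3)[of j "\<lambda>x. 1 / A x"] m2[of j] by simp
  have "risk n A m D = (LINT w|?P. (1 / real n)\<^sup>2 * (\<Sum>j\<in>UNIV.
      (\<Sum>i\<in>{1..n}. ?v j (w i)) + (\<Sum>i\<in>{1..n}. m (fst (w i)) $ j - ?\<theta> $ j)\<^sup>2))"
    unfolding risk_eq_iterated
    by (subst profile_law_def [symmetric], intro Bochner_Integration.integral_cong refl expectation_sample n)
      (simp add: profile_law_def)
  also have "\<dots> = (1 / real n)\<^sup>2 * (\<Sum>j\<in>UNIV. (LINT w|?P. (\<Sum>i\<in>{1..n}. ?v j (w i))) +
      (LINT w|?P. (\<Sum>i\<in>{1..n}. m (fst (w i)) $ j - ?\<theta> $ j)\<^sup>2))"
    using sq_int v_int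
    by (simp add: Bochner_Integration.integral_sum Bochner_Integration.integral_add
        del: Bochner_Integration.integral_diff sum_subtractf)
  also have "\<dots> = (1 / real n)\<^sup>2 * (\<Sum>j\<in>UNIV. real n *
      ((LINT x|D. (m (fst x) $ j)\<^sup>2 * (1 / A (snd x))) - (moment m D $ j)\<^sup>2))"
    unfolding sum_v sum_sq v_diff by (simp add: right_diff_distrib)
  finally show ?thesis
    using n by (simp add: power2_eq_square sum_distrib_left [symmetric])
qed

section \<open>Decomposition by cost\<close>

text \<open>Every agent has exactly one cost in the finite set \<open>C\<close>. With weight
  \<open>1 / A\<close> this yields the linear term of the objective, and with weight 1 the moment
  itself.\<close>

lemma expectation_split_by_cost:
  "(LINT y|D. m (fst y) $ j * f (snd y)) =
    (\<Sum>x\<in>C. (LINT y|D. m (fst y) $ j * indicator {x} (snd y)) * f x)"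
proof -
  have "(LINT y|D. m (fst y) $ j * f (snd y)) =
      (LINT y|D. (\<Sum>x\<in>C. m (fst y) $ j * indicator {x} (snd y) * f x))"
  proof (intro Bochner_Integration.integral_cong refl)
    fix y assume "y \<in> space D"
    then have "snd y \<in> C"
      by (auto simp: space_D)
    then have "m (fst y) $ j * f (snd y) = (\<Sum>x\<in>C. if x = snd y then m (fst y) $ j * f x else 0)"
      using finite_C by simp
    also have "\<dots> = (\<Sum>x\<in>C. m (fst y) $ j * indicator {x} (snd y) * f x)"
      by (intro sum.cong refl) auto
    finally show "m (fst y) $ j * f (snd y) = (\<Sum>x\<in>C. m (fst y) $ j * indicator {x} (snd y) * f x)" .
  qed
  also have "\<dots> = (\<Sum>x\<in>C. LINT y|D. m (fst y) $ j * indicator {x} (snd y) * f x)"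
    by (intro Bochner_Integration.integral_sum integrable_mult_left integrable_moments)
  finally show ?thesis
    by simp
qed

text \<open>Dividing by \<open>pmf F x\<close> gives the conditional mean of a moment at cost
  \<open>x\<close>; these bounds place it in the unit interval.\<close>

lemma cost_fraction_le:
  assumes marginal: "distr D (count_space UNIV) snd = measure_pmf F"
    and range: "m ` space MZ \<subseteq> cbox 0 1"
  shows "0 \<le> (LINT y|D. m (fst y) $ j * indicator {x} (snd y))"
    and "(LINT y|D. m (fst y) $ j * indicator {x} (snd y)) \<le> pmf F x"
proof -
  have m01: "0 \<le> m (fst y) $ j" "m (fst y) $ j \<le> 1" if "y \<in> space D" for y
    using range that by (auto simp: space_D mem_box_cart image_subset_iff)
  show "0 \<le> (LINT y|D. m (fst y) $ j * indicator {x} (snd y))"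
    by (intro Bochner_Integration.integral_nonneg mult_nonneg_nonneg m01) auto
  have "integrable D (\<lambda>y. indicator {x} (snd y) :: real)"
    by (rule integrable_const_bound[where B = 1]) auto
  then have "(LINT y|D. m (fst y) $ j * indicator {x} (snd y)) \<le> (LINT y|D. indicator {x} (snd y))"
    by (intro integral_mono integrable_moments mult_left_le_one_le m01) auto
  also have "\<dots> = (LINT y|distr D (count_space UNIV) snd. indicator {x} y)"
    by (rule integral_distr [symmetric]) (auto intro: measurable_compose[OF measurable_snd_D])
  also have "\<dots> = pmf F x"
    by (simp add: marginal pmf.rep_eq)
  finally show "(LINT y|D. m (fst y) $ j * indicator {x} (snd y)) \<le> pmf F x" .
qed

end

section \<open>Laws supported on two types, and vertices of the cube\<close>

text \<open>Draw the cost from \<open>F\<close>, then let the type be \<open>z1\<close> with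
  probability \<open>q x\<close> and \<open>z0\<close> otherwise. Finite support of \<open>F\<close>
  turns every expectation into a finite sum.\<close>

lemma two_point_law:
  assumes fin: "finite (set_pmf F)" and z: "z0 \<in> space MZ" "z1 \<in> space MZ"
    and q: "\<And>x. x \<in> set_pmf F \<Longrightarrow> 0 \<le> q x \<and> q x \<le> 1"
  obtains D where "D \<in> consistent_laws MZ F"
    and "\<And>h :: 'z \<times> real \<Rightarrow> real. h \<in> borel_measurable D \<Longrightarrow>
      (LINT y|D. h y) = (\<Sum>x\<in>set_pmf F. pmf F x * (q x * h (z1, x) + (1 - q x) * h (z0, x)))"
proof -
  let ?K = "MZ \<Otimes>\<^sub>M count_space (set_pmf F)"
  obtain x0 where x0: "x0 \<in> set_pmf F"
    using set_pmf_not_empty[of F] by blast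
  \<comment> \<open>The coin is recorded in place of the type, so the two branches have separate
    masses whether or not \<open>z0\<close> and \<open>z1\<close> differ.\<close>
  define P where "P = bind_pmf F (\<lambda>x. map_pmf (\<lambda>b. (b, x)) (bernoulli_pmf (q x)))"
  \<comment> \<open>The default \<open>x0\<close> sends all of \<open>bool \<times> real\<close>
    into the target space, as measurability demands. It occurs only outside the support of
    \<open>P\<close> and so leaves the cost marginal intact.\<close>
  define T where "T = (\<lambda>(b, x). (if b then z1 else z0, if x \<in> set_pmf F then x else x0))"
  define D where "D = distr (measure_pmf P) ?K T"
  have set_P: "set_pmf P \<subseteq> UNIV \<times> set_pmf F"
    by (auto simp: P_def)
  have T: "T \<in> measurable (measure_pmf P) ?K"
    using z x0 by (auto simp: T_def space_pair_measure)
  have int_P: "(LINT y|P. g y) =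
      (\<Sum>x\<in>set_pmf F. pmf F x * (q x * g (True, x) + (1 - q x) * g (False, x)))"
    for g :: "bool \<times> real \<Rightarrow> real"
  proof -
    have "pmf P y = pmf F (snd y) * pmf (bernoulli_pmf (q (snd y))) (fst y)" for y
    proof (cases y)
      case (Pair b x)
      have "pmf P (b, x) = measure_pmf.expectation F
          (\<lambda>x'. indicator {x} x' * pmf (bernoulli_pmf (q x)) b)"
        unfolding P_def pmf_bind
      proof (intro Bochner_Integration.integral_cong refl)
        fix x'
        show "pmf (map_pmf (\<lambda>b. (b, x')) (bernoulli_pmf (q x'))) (b, x) =
            indicator {x} x' * pmf (bernoulli_pmf (q x)) b"
          using pmf_map_inj'[of "\<lambda>b. (b, x')" "bernoulli_pmf (q x')" b]
          by (cases "x' = x") (auto simp: inj_on_def pmf_eq_0_set_pmf)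
      qed
      then show ?thesis
        by (simp add: pmf.rep_eq Pair)
    qed
    moreover have "(LINT y|P. g y) = (\<Sum>y\<in>UNIV \<times> set_pmf F. pmf P y *\<^sub>R g y)"
      using set_P fin by (intro integral_measure_pmf) auto
    ultimately have "(LINT y|P. g y) =
        (\<Sum>b\<in>UNIV. \<Sum>x\<in>set_pmf F. pmf F x * pmf (bernoulli_pmf (q x)) b * g (b, x))"
      by (simp add: sum.cartesian_product split_def)
    also have "\<dots> = (\<Sum>x\<in>set_pmf F. \<Sum>b\<in>UNIV. pmf F x * pmf (bernoulli_pmf (q x)) b * g (b, x))"
      by (rule sum.swap)
    also have "\<dots> = (\<Sum>x\<in>set_pmf F. pmf F x * (q x * g (True, x) + (1 - q x) * g (False, x)))"
      by (intro sum.cong refl) (use q in \<open>auto simp: UNIV_bool algebra_simps\<close>)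
    finally show ?thesis .
  qed
  show ?thesis
  proof
    have "distr D (count_space UNIV) snd = distr (measure_pmf P) (count_space UNIV) (snd \<circ> T)"
      unfolding D_def
      by (rule distr_distr[OF _ T]) (auto intro: measurable_compose[OF measurable_snd])
    also have "\<dots> = distr (measure_pmf P) (count_space UNIV) snd"
      using set_P by (intro distr_cong_AE) (auto simp: AE_measure_pmf_iff T_def)
    also have "\<dots> = measure_pmf (map_pmf snd P)"
      by (simp add: map_pmf_rep_eq)
    also have "map_pmf snd P = F"
      by (simp add: P_def map_bind_pmf map_pmf_comp bind_return_pmf')
    finally show "D \<in> consistent_laws MZ F"
      using prob_space.prob_space_distr[OF measure_pmf.prob_space_axioms T]
      by (simp add: consistent_laws_def D_def)
    show "(LINT y|D. h y) = (\<Sum>x\<in>set_pmf F. pmf F x * (q x * h (z1, x) + (1 - q x) * h (z0, x)))"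
      if "h \<in> borel_measurable D" for h :: "'z \<times> real \<Rightarrow> real"
    proof -
      have "(LINT y|D. h y) = (LINT y|P. h (T y))"
        unfolding D_def by (rule integral_distr[OF T]) (use that in \<open>simp add: D_def\<close>)
      then show ?thesis
        by (simp add: int_P T_def)
    qed
  qed
qed

text \<open>In each coordinate, a combination of nonnegative numbers with positive weights vanishes
  only if both numbers do. At 1 the same argument applies to \<open>1 - a $ i\<close> and
  \<open>1 - b $ i\<close>.\<close>

lemma extreme_point_cbox_0_1:
  "(0 :: real ^ 'd) extreme_point_of cbox 0 1" "(1 :: real ^ 'd) extreme_point_of cbox 0 1"
proof -
  have *: "a = b" if x_seg: "x \<in> open_segment a b" "a \<in> cbox 0 1" "b \<in> cbox 0 1" "x = 0 \<or> x = 1"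
    for a b x :: "real ^ 'd"
  proof -
    obtain u where u: "0 < u" "u < 1" "x = (1 - u) *\<^sub>R a + u *\<^sub>R b"
      using x_seg by (auto simp: in_segment)
    have "a $ i = b $ i" for i
    proof -
      have ab: "0 \<le> a $ i" "a $ i \<le> 1" "0 \<le> b $ i" "b $ i \<le> 1"
        using that by (auto simp: mem_box_cart)
      have x: "x $ i = (1 - u) * a $ i + u * b $ i"
        by (simp add: u)
      from that(4) show ?thesis
      proof
        assume "x = 0"
        then have "(1 - u) * a $ i + u * b $ i = 0" using x by simp
        then have "(1 - u) * a $ i = 0 \<and> u * b $ i = 0"
          using ab u by (subst (asm) add_nonneg_eq_0_iff) auto
        then show ?thesis using u by simp
      next
        assume "x = 1"
        then have "(1 - u) * (1 - a $ i) + u * (1 - b $ i) = 0" using x by (simp add: algebra_simps)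
        then have "(1 - u) * (1 - a $ i) = 0 \<and> u * (1 - b $ i) = 0"
          using ab u by (subst (asm) add_nonneg_eq_0_iff) auto
        then show ?thesis using u by simp
      qed
    qed
    then show ?thesis
      by (simp add: vec_eq_iff)
  qed
  have "x extreme_point_of cbox 0 1" if x: "x = 0 \<or> x = 1" for x :: "real ^ 'd"
    unfolding extreme_point_of_def
  proof (intro conjI ballI notI)
    show "x \<in> cbox 0 1"
      using x by (auto simp: mem_box_cart)
    fix a b :: "real ^ 'd"
    assume ab: "a \<in> cbox 0 1" "b \<in> cbox 0 1" "x \<in> open_segment a b"
    then have "a = b"
      using x by (intro *)
    then show False
      using ab(3) by simp
  qed
  then show "(0 :: real ^ 'd) extreme_point_of cbox 0 1" "(1 :: real ^ 'd) extreme_point_of cbox 0 1"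
    by simp_all
qed

section \<open>The worst-case risk as an optimisation over conditional means\<close>

theorem lemma3:
  fixes MZ :: "'z measure"
    and m :: "'z \<Rightarrow> real ^ 'd"
    and F :: "real pmf"
    and A :: "real \<Rightarrow> real"
    and c :: "nat \<Rightarrow> real"
    and n k :: nat
  assumes n: "n \<ge> 1"
    and c_mono: "strict_mono_on {1..k} c"
    and support: "set_pmf F = c ` {1..k}"
    and A: "\<And>t. t \<in> {1..k} \<Longrightarrow> 0 < A (c t) \<and> A (c t) \<le> 1"
    and m_measurable: "m \<in> borel_measurable MZ"
    and m_range: "m ` space MZ \<subseteq> cbox 0 1"
    and m_extreme: "{x. x extreme_point_of (cbox 0 1)} \<subseteq> m ` space MZ"
  shows "ereal (real n / real CARD('d)) * worst_case_risk n MZ A m F =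
    (SUP q\<in>{1..k} \<rightarrow>\<^sub>E {0..1::real}.
      ereal ((\<Sum>t=1..k. pmf F (c t) * (q t / A (c t))) - (\<Sum>t=1..k. pmf F (c t) * q t)\<^sup>2))"
proof -
  let ?C = "set_pmf F"
  let ?Q = "{1..k} \<rightarrow>\<^sub>E {0..1::real}"
  define G where "G q = (\<Sum>t=1..k. pmf F (c t) * (q t / A (c t))) - (\<Sum>t=1..k. pmf F (c t) * q t)\<^sup>2"
    for q
  \<comment> \<open>This is the objective indexed by cost values rather than by their ranks, which
    matches integrals over \<open>D\<close>; injectivity of \<open>c\<close> relates the two
    forms.\<close>
  define G' where "G' q = (\<Sum>x\<in>?C. pmf F x * q x * (1 / A x)) - (\<Sum>x\<in>?C. pmf F x * q x)\<^sup>2" for q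
  have inj: "inj_on c {1..k}"
    using c_mono by (rule strict_mono_on_imp_inj_on)
  have G'_eq: "G' q = G (\<lambda>t\<in>{1..k}. q (c t))" for q
    unfolding G'_def G_def support sum.reindex[OF inj] by simp
  have survey: "survey D MZ ?C A m" if "D \<in> consistent_laws MZ F" for D
  proof -
    interpret prob_space D
      using that by (simp add: consistent_laws_def)
    show ?thesis
      using that A m_measurable bounded_subset[OF bounded_cbox m_range]
      by unfold_locales (auto simp: consistent_laws_def support)
  qed
  have upper: "ereal (real n / real CARD('d) * risk n A m D) \<le> (SUP q\<in>?Q. ereal (G q))"
    if D: "D \<in> consistent_laws MZ F" for D
  proof -
    interpret survey D MZ ?C A m
      by (rule survey[OF D])
    have marginal: "distr D (count_space UNIV) snd = measure_pmf F"
      using D by (simp add: consistent_laws_def)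
    define r where "r j = (LINT x|D. (m (fst x) $ j)\<^sup>2 * (1 / A (snd x))) - (moment m D $ j)\<^sup>2" for j
    \<comment> \<open>The conditional mean of the \<open>j\<close>-th moment given cost
      \<open>x\<close>. It is 0 when \<open>pmf F x = 0\<close>, so the bounds \<open>q01\<close>
      hold for every \<open>x\<close>.\<close>
    define q where "q j x = (LINT y|D. m (fst y) $ j * indicator {x} (snd y)) / pmf F x" for j x
    have q: "pmf F x * q j x = (LINT y|D. m (fst y) $ j * indicator {x} (snd y))" if "x \<in> ?C" for j x
      using that by (simp add: q_def pmf_eq_0_set_pmf)
    have q01: "0 \<le> q j x" "q j x \<le> 1" for j x
      using cost_fraction_le[OF marginal m_range, of j x]
      by (auto simp: q_def divide_le_eq_1 pmf_nonneg order.strict_iff_order)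
    have r_le: "r j \<le> G' (q j)" for j
    proof -
      have "(LINT x|D. (m (fst x) $ j)\<^sup>2 * (1 / A (snd x))) \<le> (LINT x|D. m (fst x) $ j * (1 / A (snd x)))"
      proof (intro integral_mono integrable_moments mult_right_mono)
        fix x assume "x \<in> space D"
        then have x: "fst x \<in> space MZ" "snd x \<in> ?C"
          by (auto simp: space_D)
        then show "0 \<le> 1 / A (snd x)"
          using survey.A[OF survey[OF D]] by (simp add: less_imp_le)
        have "0 \<le> m (fst x) $ j" "m (fst x) $ j \<le> 1"
          using x m_range by (auto simp: mem_box_cart image_subset_iff)
        then show "(m (fst x) $ j)\<^sup>2 \<le> m (fst x) $ j"
          by (simp add: power2_eq_square mult_left_le_one_le)
      qed
      also have "\<dots> = (\<Sum>x\<in>?C. pmf F x * q j x * (1 / A x))"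
        by (subst expectation_split_by_cost[where f = "\<lambda>x. 1 / A x"]) (intro sum.cong refl, simp only: q)
      finally show ?thesis
        \<comment> \<open>The constant weight shows that the squared terms of \<open>r j\<close> and
          \<open>G' (q j)\<close> agree.\<close>
        using expectation_split_by_cost[of j "\<lambda>_. 1"] q
        by (simp add: r_def G'_def moment_component)
    qed
    \<comment> \<open>Different coordinates have different vectors \<open>q j\<close>, so the
      average is bounded by a single coordinate that is at least as large.\<close>
    obtain j where "(\<Sum>j\<in>UNIV. r j) \<le> real CARD('d) * r j"
    proof (rule ccontr)
      assume "\<not> thesis"
      with that have "\<not> (\<Sum>j\<in>UNIV. r j) \<le> real CARD('d) * r j" for j
        by blast
      then have "(\<Sum>j\<in>UNIV. real CARD('d) * r j) < (\<Sum>j\<in>(UNIV :: 'd set). \<Sum>i\<in>UNIV. r i)"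
        by (intro sum_strict_mono[of UNIV]) (auto simp: not_le)
      then show False
        by (simp add: sum_distrib_left [symmetric])
    qed
    then have "real n / real CARD('d) * risk n A m D \<le> r j"
      using risk_eq[OF n, folded r_def] by (simp add: divide_le_eq mult.commute)
    also have "\<dots> \<le> G (\<lambda>t\<in>{1..k}. q j (c t))"
      using r_le[of j] by (simp add: G'_eq)
    also have "ereal \<dots> \<le> (SUP q\<in>?Q. ereal (G q))"
      by (intro SUP_upper) (auto simp: q01)
    finally show ?thesis
      by simp
  qed
  have lower: "\<exists>D\<in>consistent_laws MZ F. G q = real n / real CARD('d) * risk n A m D"
    if q: "q \<in> ?Q" for q
  proof -
    \<comment> \<open>The vector \<open>q\<close> is moved from ranks to cost values.\<close>
    define p where "p = q \<circ> the_inv_into {1..k} c"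
    have p_c: "p (c t) = q t" if "t \<in> {1..k}" for t
      using the_inv_into_f_f[OF inj that] by (simp add: p_def)
    have p01: "0 \<le> p x \<and> p x \<le> 1" if "x \<in> ?C" for x
      using that q by (auto simp: support p_c PiE_iff)
    obtain z0 z1 where z: "z0 \<in> space MZ" "m z0 = 0" "z1 \<in> space MZ" "m z1 = 1"
    proof -
      have "0 \<in> m ` space MZ" "1 \<in> m ` space MZ"
        using m_extreme extreme_point_cbox_0_1 by auto
      then show ?thesis
        using that by (metis imageE)
    qed
    have fin: "finite ?C"
      by (simp add: support)
    obtain D where D: "D \<in> consistent_laws MZ F"
      and int: "\<And>h :: 'z \<times> real \<Rightarrow> real. h \<in> borel_measurable D \<Longrightarrow>
        (LINT y|D. h y) = (\<Sum>x\<in>?C. pmf F x * (p x * h (z1, x) + (1 - p x) * h (z0, x)))"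
      using two_point_law[where q = p, OF fin z(1,3) p01, of thesis] by blast
    interpret survey D MZ ?C A m
      by (rule survey[OF D])
    \<comment> \<open>Since \<open>m\<close> is 1 at \<open>z1\<close> and 0 at \<open>z0\<close>,
      squaring changes nothing and each of the \<open>CARD('d)\<close> coordinates contributes
      \<open>G' p\<close>.\<close>
    have "real n * risk n A m D = real CARD('d) * G' p"
      unfolding risk_eq[OF n] moment_component
      by (subst int, measurable, subst int, measurable) (simp add: z G'_def mult.assoc)
    moreover have "G' p = G q"
      using p_c by (simp add: G'_eq G_def)
    ultimately show ?thesis
      using D by (intro bexI[of _ D]) (simp_all add: field_simps)
  qed
  \<comment> \<open>Nonemptiness lets the factor pass through the supremum in the extended reals;
    the zero vector supplies a law.\<close>
  have nonempty: "consistent_laws MZ F \<noteq> {}"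
    using lower[of "\<lambda>t\<in>{1..k}. 0"] by auto
  have "ereal (real n / real CARD('d)) * worst_case_risk n MZ A m F =
      (SUP D\<in>consistent_laws MZ F. ereal (real n / real CARD('d) * risk n A m D))"
    unfolding worst_case_risk_def by (subst Sup_ereal_mult_left'[OF nonempty]) simp_all
  also have "\<dots> = (SUP q\<in>?Q. ereal (G q))"
  proof (rule antisym)
    show "(SUP D\<in>consistent_laws MZ F. ereal (real n / real CARD('d) * risk n A m D)) \<le>
        (SUP q\<in>?Q. ereal (G q))"
      by (rule SUP_least) (rule upper)
    show "(SUP q\<in>?Q. ereal (G q)) \<le>
        (SUP D\<in>consistent_laws MZ F. ereal (real n / real CARD('d) * risk n A m D))"
    proof (rule SUP_mono)
      fix q assume "q \<in> ?Q"
      then obtain D where "D \<in> consistent_laws MZ F" "G q = real n / real CARD('d) * risk n A m D"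
        using lower by blast
      then show "\<exists>D\<in>consistent_laws MZ F.
          ereal (G q) \<le> ereal (real n / real CARD('d) * risk n A m D)"
        by (intro bexI[of _ D]) simp_all
    qed
  qed
  finally show ?thesis
    by (simp add: G_def)
qed

end
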